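(* Let $\bm X_{\rm vec}\sim N(\bm\mu_{\bm X_{\rm vec}},\Sigma_{\bm X_{\rm vec}})$ in $\mathbb R^{nd}$ and $\bm Y_{\rm vec}\sim N(\bm\mu_{\bm Y_{\rm vec}},\Sigma_{\bm Y_{\rm vec}})$ in $\mathbb R^{md}$ be independent, with unknown means and known covariance matrices, being the row-wise vectorizations of random matrices $X\in\mathbb R^{n\times d}$ and $Y\in\mathbb R^{m\times d}$. Let $(X^{\rm obs},Y^{\rm obs})$ be observed data, with sign vectors $\mathcal S_k(X^{\rm obs},Y^{\rm obs})$, $k\in[d]$, and selected set of basic variables $\mathcal M_{\rm obs}=\mathcal M(X^{\rm obs},Y^{\rm obs})$ of the linear program defining the $d$-dimensional Wasserstein distance. Assume that the event $E=\{\mathcal S_k(X,Y)=\mathcal S_k(X^{\rm obs},Y^{\rm obs})\ \forall k\in[d],\ \mathcal M(X,Y)=\mathcal M_{\rm obs}\}$ has positive probability. Let $\bm\eta_{\rm mul}$ be the test-statistic direction determined by the observed sign vectors and $\mathcal M_{\rm obs}$, assume $\sigma^2_{\rm mul}=\bm\eta_{\rm mul}^\top\tilde\Sigma^{\rm mul}\bm\eta_{\rm mul}>0$, and let $W^\ast=\bm\eta_{\rm mul}^\top\binom{\bm\mu_{\bm X_{\rm vec}}}{\bm\mu_{\bm Y_{\rm vec}}}$. For $\alpha\in[0,1]$ let, on $E$, $$C^{\rm mul}_{\rm sel}=\left\{w\in\mathbb R:\ \frac{\alpha}{2}\le F^{\mathcal Z^{\rm mul}}_{w,\sigma^2_{\rm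 mul}}\left(\bm\eta_{\rm mul}^\top\binom{\bm X_{\rm vec}}{\bm Y_{\rm vec}}\right)\le 1-\frac{\alpha}{2}\right\},$$ where $F^{\mathcal Z^{\rm mul}}_{w,\sigma^2_{\rm mul}}$ is the c.d.f. of $N(w,\sigma^2_{\rm mul})$ truncated to the set $\mathcal Z^{\rm mul}=\mathcal Z^{\rm mul}(X,Y)$ defined in the context. Then for every $\alpha\in[0,1]$, $$\mathbb P\big(W^\ast\in C^{\rm mul}_{\rm sel}\ \big|\ E\big)=1-\alpha .$$
   Context: All vectors are columns; $\binom{\bm X_{\rm vec}}{\bm Y_{\rm vec}}\in\mathbb R^{nd+md}$ is the stacked vector, where $\bm X_{\rm vec}$ concatenates the rows $\bm x_{1,:},\dots,\bm x_{n,:}\in\mathbb R^d$ of $X$ and $\bm Y_{\rm vec}$ the rows $\bm y_{1,:},\dots,\bm y_{m,:}\in\mathbb R^d$ of $Y$. $\tilde\Sigma^{\rm mul}=\begin{pmatrix}\Sigma_{\bm X_{\rm vec}}&0\\0&\Sigma_{\bm Y_{\rm vec}}\end{pmatrix}$. Matrix $\Omega\in\mathbb R^{nm\times(n+m)}$: its rows are indexed by pairs $(i,j)$, $i\in[n]$, $j\in[m]$, in row-major order (row number $(i-1)m+j$), and row $(i,j)$ has $+1$ in column $i$, $-1$ in column $n+j$, and $0$ elsewhere. With $\bm e_{d,k}\in\mathbb R^d$ the $k$-th unit vector and $\otimes$ the Kronecker product, $\mathcal S_k(X,Y)=\mathrm{sign}\big((\Omega\otimes\bm e_{d,k}^\top)\binom{\bm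 X_{\rm vec}}{\bm Y_{\rm vec}}\big)\in\mathbb R^{nm}$ (entries $\mathrm{sign}(x_{i,k}-y_{j,k})$), and $\Theta^{\rm mul}=\sum_{k=1}^d\mathcal S_k(X,Y)\circ(\Omega\otimes\bm e_{d,k}^\top)\in\mathbb R^{nm\times(nd+md)}$, where $\bm s\circ A$ multiplies each row of $A$ by the corresponding entry of $\bm s$. The vectorized cost matrix is $\bm c(X,Y)=\Theta^{\rm mul}\binom{\bm X_{\rm vec}}{\bm Y_{\rm vec}}$, whose $(i,j)$ entry is $\sum_{k=1}^d|x_{i,k}-y_{j,k}|$. Linear program (Wasserstein distance between the empirical measures of the rows of $X$ and of $Y$): minimize $\bm t^\top\bm c(X,Y)$ over $\bm t\in\mathbb R^{nm}$ subject to $S\bm t=\bm h$, $\bm t\ge\bm 0$. Here $S$ is obtained from the $(n+m)\times nm$ matrix with the $n$ constraints $\sum_j t_{ij}$ ($i\in[n]$) followed by the $m$ constraints $\sum_i t_{ij}$ ($j\in[m]$), and $\bm h$ from the vector with entries $1/n$ ($n$ times) followed by $1/m$ ($m$ times), by deleting the last (redundant) row of $S$ and the last entry of $\bm h$. The LP is assumed non-degenerate. $\mathcal M(X,Y)\subset[nm]$, of size $n+m-1$, is the set of indices of basic variables of the optimal basis returned when the LP is solved on the data $(X,Y)$; it is a fixed (deterministic, measurable) function of the data. Put $\hat{\bm t}_{\mathcal M_{\rm obs}}=S_{:,\mathcal M_{\rm obs}}^{-1}\bm h$ ($S_{:,\mathcal M_{\rm obs}}$: columns of $S$ in $\mathcal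 M_{\rm obs}$) and $\bm\eta_{\rm mul}=(\Theta^{\rm mul}_{\mathcal M_{\rm obs},:})^\top\hat{\bm t}_{\mathcal M_{\rm obs}}$, where $\Theta^{\rm mul}$ is formed with the observed sign vectors $\mathcal S_k(X^{\rm obs},Y^{\rm obs})$ and $\Theta^{\rm mul}_{\mathcal M_{\rm obs},:}$ denotes its rows in $\mathcal M_{\rm obs}$. On the event $E$ the Wasserstein distance equals $\bm\eta_{\rm mul}^\top\binom{\bm X_{\rm vec}}{\bm Y_{\rm vec}}$. Let $\bm b^{\rm mul}=\tilde\Sigma^{\rm mul}\bm\eta_{\rm mul}(\bm\eta_{\rm mul}^\top\tilde\Sigma^{\rm mul}\bm\eta_{\rm mul})^{-1}$ and $\bm q(X,Y)=(I_{nd+md}-\bm b^{\rm mul}\bm\eta_{\rm mul}^\top)\binom{\bm X_{\rm vec}}{\bm Y_{\rm vec}}$. The truncation region is $$\mathcal Z^{\rm mul}(X,Y)=\{z\in\mathbb R:\ \mathcal S_k(\bm q(X,Y)+\bm b^{\rm mul}z)=\mathcal S_k(X^{\rm obs},Y^{\rm obs})\ \forall k\in[d],\ \mathcal M(\bm q(X,Y)+\bm b^{\rm mul}z)=\mathcal M_{\rm obs}\},$$ where $\mathcal S_k(\cdot)$ and $\mathcal M(\cdot)$ applied to a vector in $\mathbb R^{nd+md}$ mean the same functions applied to the matrices whose vectorizations are its two blocks. *)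

theory Defs
  imports "HOL-Probability.Probability"
begin

section \<open>Gaussian random vectors\<close>

definition std_normal_vec :: "(real ^ 'k) measure" where
  "std_normal_vec = density lborel (\<lambda>z. ennreal (\<Prod>i\<in>UNIV. std_normal_density (z $ i)))"

text \<open>The law \<open>N(\<mu>, \<Sigma>)\<close>, with \<open>\<Sigma>\<close> possibly singular: the law of \<open>\<mu> + A Z\<close> with \<open>Z\<close> standard
  normal and \<open>A A\<^sup>T = \<Sigma>\<close>.\<close>

definition multivariate_normal ::
    "'w measure \<Rightarrow> ('w \<Rightarrow> real ^ 'k) \<Rightarrow> real ^ 'k \<Rightarrow> real ^ 'k ^ 'k \<Rightarrow> bool" where
  "multivariate_normal P V \<mu> \<Sigma> \<longleftrightarrow>
     V \<in> borel_measurable P \<and>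
     (\<exists>A :: real ^ 'k ^ 'k. A ** transpose A = \<Sigma> \<and>
        distr P borel V = distr std_normal_vec borel (\<lambda>z. \<mu> + A *v z))"

text \<open>Independence of two random vectors; the library's \<open>indep_var\<close> requires both to have the same
  type, hence its formulation through the generated \<open>\<sigma>\<close>-algebras.\<close>

definition indep_vecs :: "'w measure \<Rightarrow> ('w \<Rightarrow> real ^ 'k) \<Rightarrow> ('w \<Rightarrow> real ^ 'l) \<Rightarrow> bool" where
  "indep_vecs P V W \<longleftrightarrow>
     prob_space.indep_set P {V -` A \<inter> space P |A. A \<in> sets borel}
       {W -` A \<inter> space P |A. A \<in> sets borel}"

text \<open>The c.d.f. of \<open>N(w, v)\<close>, where \<open>v\<close> is the variance, truncated to \<open>Z\<close>.\<close>

definition truncated_normal_cdf :: "real set \<Rightarrow> real \<Rightarrow> real \<Rightarrow> real \<Rightarrow> real" where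
  "truncated_normal_cdf Z w v =
     cdf (uniform_measure (density lborel (\<lambda>x. ennreal (normal_density w (sqrt v) x))) Z)"

section \<open>Linear programs in standard form\<close>

text \<open>Minimise \<open>c \<bullet> t\<close> subject to \<open>A t = b\<close>, \<open>t \<ge> 0\<close>.\<close>

definition lp_feasible :: "real ^ 'v ^ 'c \<Rightarrow> real ^ 'c \<Rightarrow> real ^ 'v \<Rightarrow> bool" where
  "lp_feasible A b t \<longleftrightarrow> A *v t = b \<and> (\<forall>p. 0 \<le> t $ p)"

definition lp_optimal :: "real ^ 'v ^ 'c \<Rightarrow> real ^ 'c \<Rightarrow> real ^ 'v \<Rightarrow> real ^ 'v \<Rightarrow> bool" where
  "lp_optimal A b c t \<longleftrightarrow> lp_feasible A b t \<and> (\<forall>t'. lp_feasible A b t' \<longrightarrow> t \<bullet> c \<le> t' \<bullet> c)"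

text \<open>Submatrices are zero-padded so that they keep their index types.  Accordingly, the inverse
  of the square matrix \<open>A\<^bsub>:,B\<^esub>\<close> is represented by a matrix whose rows outside \<open>B\<close> vanish.\<close>

definition restrict_cols :: "'v set \<Rightarrow> real ^ 'v ^ 'c \<Rightarrow> real ^ 'v ^ 'c" where
  "restrict_cols B A = (\<chi> r p. if p \<in> B then A $ r $ p else 0)"

definition restrict_rows :: "'v set \<Rightarrow> real ^ 'c ^ 'v \<Rightarrow> real ^ 'c ^ 'v" where
  "restrict_rows B A = (\<chi> p r. if p \<in> B then A $ p $ r else 0)"

definition is_col_inverse :: "real ^ 'v ^ 'c \<Rightarrow> 'v set \<Rightarrow> real ^ 'c ^ 'v \<Rightarrow> bool" where
  "is_col_inverse A B N \<longleftrightarrow>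
     restrict_cols B A ** N = mat 1 \<and> N ** restrict_cols B A = restrict_cols B (mat 1)"

definition col_inverse :: "real ^ 'v ^ 'c \<Rightarrow> 'v set \<Rightarrow> real ^ 'c ^ 'v" where
  "col_inverse A B = (THE N. is_col_inverse A B N)"

lemma is_col_inverse_rows:
  assumes "is_col_inverse A B N"
  shows "restrict_rows B N = N"
proof -
  have "N $ p $ r = 0" if "p \<notin> B" for p r
  proof -
    have *: "N = restrict_cols B (mat 1) ** N"
      using assms by (metis is_col_inverse_def matrix_mul_assoc matrix_mul_rid)
    have "(restrict_cols B (mat 1) ** N) $ p $ r = (\<Sum>k\<in>UNIV. 0)"
      unfolding matrix_matrix_mult_def restrict_cols_def mat_def
      by (auto simp: that intro!: sum.neutral)
    then show ?thesis using * by simp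
  qed
  then show ?thesis by (simp add: restrict_rows_def vec_eq_iff)
qed

lemma is_col_inverse_unique:
  assumes "is_col_inverse A B N" "is_col_inverse A B N'"
  shows "N = N'"
  using assms unfolding is_col_inverse_def
  by (metis matrix_mul_assoc matrix_mul_lid matrix_mul_rid)

lemma col_inverse_eq: "is_col_inverse A B N \<Longrightarrow> col_inverse A B = N"
  unfolding col_inverse_def by (blast intro: is_col_inverse_unique)

definition is_basis :: "real ^ 'v ^ 'c \<Rightarrow> 'v set \<Rightarrow> bool" where
  "is_basis A B \<longleftrightarrow> card B = CARD('c) \<and> (\<exists>N. is_col_inverse A B N)"

definition basic_solution :: "real ^ 'v ^ 'c \<Rightarrow> real ^ 'c \<Rightarrow> 'v set \<Rightarrow> real ^ 'v" where
  "basic_solution A b B = col_inverse A B *v b"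

definition optimal_basis :: "real ^ 'v ^ 'c \<Rightarrow> real ^ 'c \<Rightarrow> real ^ 'v \<Rightarrow> 'v set \<Rightarrow> bool" where
  "optimal_basis A b c B \<longleftrightarrow> is_basis A B \<and> lp_optimal A b c (basic_solution A b B)"

definition lp_nondegenerate :: "real ^ 'v ^ 'c \<Rightarrow> real ^ 'c \<Rightarrow> bool" where
  "lp_nondegenerate A b \<longleftrightarrow>
     (\<forall>B. is_basis A B \<and> lp_feasible A b (basic_solution A b B) \<longrightarrow>
        (\<forall>p\<in>B. 0 < basic_solution A b B $ p))"

section \<open>The transport constraints\<close>

text \<open>The row indices of \<open>S\<close>: all \<open>n + m\<close> marginal constraints except the last one.\<close>

typedef (overloaded) ('n, 'm) constr = "{r :: 'n::finite + 'm::{finite,linorder}. r \<noteq> Inr (Max UNIV)}"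
  by blast

instance constr :: (finite, "{finite,linorder}") finite
proof
  have "finite (Abs_constr ` {r :: 'a + 'b. r \<noteq> Inr (Max UNIV)})"
    by simp
  moreover have "(UNIV :: ('a, 'b) constr set) = Abs_constr ` {r. r \<noteq> Inr (Max UNIV)}"
    using type_definition.Abs_image[OF type_definition_constr] by metis
  ultimately show "finite (UNIV :: ('a, 'b) constr set)" by simp
qed

lemma card_constr:
  "CARD(('n::finite, 'm::{finite,linorder}) constr) = CARD('n) + CARD('m) - 1"
proof -
  have "CARD(('n, 'm) constr) = card (UNIV - {Inr (Max UNIV) :: 'n + 'm})"
    by (simp add: type_definition.card[OF type_definition_constr] set_diff_eq)
  then show ?thesis by (simp add: card_Diff_singleton)
qed

definition S_full :: "real ^ ('n::finite \<times> 'm::finite) ^ ('n + 'm)" where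
  "S_full = (\<chi> r p. case r of Inl i \<Rightarrow> if fst p = i then 1 else 0
                             | Inr j \<Rightarrow> if snd p = j then 1 else 0)"

definition h_full :: "real ^ ('n::finite + 'm::finite)" where
  "h_full = (\<chi> r. case r of Inl i \<Rightarrow> 1 / real CARD('n) | Inr j \<Rightarrow> 1 / real CARD('m))"

definition S_ot :: "real ^ ('n::finite \<times> 'm::{finite,linorder}) ^ ('n, 'm) constr" where
  "S_ot = (\<chi> r. S_full $ Rep_constr r)"

definition h_ot :: "real ^ ('n::finite, 'm::{finite,linorder}) constr" where
  "h_ot = (\<chi> r. h_full $ Rep_constr r)"

section \<open>Vectorization and the cost vector\<close>

text \<open>The \<open>nd + md\<close> coordinates of a stacked vector are indexed by \<open>('n + 'm) \<times> 'd\<close>, which is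
  the column index type of the Kronecker product of \<open>\<Omega>\<close> with a row vector.\<close>

definition vec_rows :: "real ^ 'd ^ 'n \<Rightarrow> real ^ ('n::finite \<times> 'd::finite)" where
  "vec_rows X = (\<chi> p. X $ fst p $ snd p)"

definition stack ::
    "real ^ ('n \<times> 'd) \<Rightarrow> real ^ ('m \<times> 'd) \<Rightarrow> real ^ (('n::finite + 'm::finite) \<times> 'd::finite)" where
  "stack u v = (\<chi> p. case fst p of Inl i \<Rightarrow> u $ (i, snd p) | Inr j \<Rightarrow> v $ (j, snd p))"

definition unstack_X :: "real ^ (('n::finite + 'm::finite) \<times> 'd::finite) \<Rightarrow> real ^ 'd ^ 'n" where
  "unstack_X v = (\<chi> i k. v $ (Inl i, k))"

definition unstack_Y :: "real ^ (('n::finite + 'm::finite) \<times> 'd::finite) \<Rightarrow> real ^ 'd ^ 'm" where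
  "unstack_Y v = (\<chi> j k. v $ (Inr j, k))"

lemma unstack_stack [simp]:
  "unstack_X (stack (vec_rows X) (vec_rows Y)) = X"
  "unstack_Y (stack (vec_rows X) (vec_rows Y)) = Y"
  by (simp_all add: unstack_X_def unstack_Y_def stack_def vec_rows_def vec_eq_iff)

definition block_diag ::
    "real ^ ('n \<times> 'd) ^ ('n \<times> 'd) \<Rightarrow> real ^ ('m \<times> 'd) ^ ('m \<times> 'd) \<Rightarrow>
     real ^ (('n::finite + 'm::finite) \<times> 'd::finite) ^ (('n + 'm) \<times> 'd)" where
  "block_diag A B = (\<chi> p q. case (fst p, fst q) of
       (Inl i, Inl i') \<Rightarrow> A $ (i, snd p) $ (i', snd q)
     | (Inr j, Inr j') \<Rightarrow> B $ (j, snd p) $ (j', snd q)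
     | _ \<Rightarrow> 0)"

definition Omega :: "real ^ ('n::finite + 'm::finite) ^ ('n \<times> 'm)" where
  "Omega = (\<chi> p r. case r of Inl i \<Rightarrow> if i = fst p then 1 else 0
                            | Inr j \<Rightarrow> if j = snd p then -1 else 0)"

text \<open>\<open>A \<otimes> v\<^sup>T\<close>\<close>

definition kron_row :: "real ^ 'c ^ 'r \<Rightarrow> real ^ 'd \<Rightarrow> real ^ ('c::finite \<times> 'd::finite) ^ 'r" where
  "kron_row A v = (\<chi> r q. A $ r $ fst q * v $ snd q)"

text \<open>\<open>s \<circ> A\<close>\<close>

definition scale_rows :: "real ^ 'r \<Rightarrow> real ^ 'c ^ 'r \<Rightarrow> real ^ 'c ^ 'r" where
  "scale_rows s A = (\<chi> r. s $ r *\<^sub>R A $ r)"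

definition sign_vec ::
    "'d \<Rightarrow> real ^ 'd ^ 'n \<Rightarrow> real ^ 'd ^ 'm \<Rightarrow> real ^ ('n::finite \<times> 'm::finite)" where
  "sign_vec k X Y =
     (\<chi> p. sgn ((kron_row Omega (axis (k::'d::finite) 1) *v stack (vec_rows X) (vec_rows Y)) $ p))"

definition Theta_mul ::
    "real ^ 'd ^ 'n \<Rightarrow> real ^ 'd ^ 'm \<Rightarrow>
     real ^ (('n::finite + 'm::finite) \<times> 'd::finite) ^ ('n \<times> 'm)" where
  "Theta_mul X Y = (\<Sum>k\<in>UNIV. scale_rows (sign_vec k X Y) (kron_row Omega (axis k 1)))"

definition cost_vec ::
    "real ^ 'd::finite ^ 'n \<Rightarrow> real ^ 'd ^ 'm \<Rightarrow> real ^ ('n::finite \<times> 'm::finite)" where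
  "cost_vec X Y = Theta_mul X Y *v stack (vec_rows X) (vec_rows Y)"

lemma Omega_stack:
  fixes X :: "real ^ 'd::finite ^ 'n::finite" and Y :: "real ^ 'd ^ 'm::finite"
  shows "(kron_row Omega (axis k 1) *v stack (vec_rows X) (vec_rows Y)) $ (i, j) =
     X $ i $ k - Y $ j $ k"
proof -
  have *: "(\<Sum>q\<in>UNIV. f q) = (\<Sum>i\<in>UNIV. \<Sum>l\<in>UNIV. f (Inl i, l)) + (\<Sum>j\<in>UNIV. \<Sum>l\<in>UNIV. f (Inr j, l))"
    for f :: "('n + 'm) \<times> 'd \<Rightarrow> real"
  proof -
    have "(\<Sum>q\<in>UNIV. f q) = (\<Sum>r\<in>UNIV. \<Sum>l\<in>UNIV. f (r, l))"
      by (simp add: sum.cartesian_product)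
    also have "\<dots> = (\<Sum>r\<in>(UNIV :: 'n set) <+> (UNIV :: 'm set). \<Sum>l\<in>UNIV. f (r, l))"
      by simp
    also have "\<dots> = (\<Sum>i\<in>UNIV. \<Sum>l\<in>UNIV. f (Inl i, l)) + (\<Sum>j\<in>UNIV. \<Sum>l\<in>UNIV. f (Inr j, l))"
      by (subst sum.Plus) simp_all
    finally show ?thesis .
  qed
  let ?g = "\<lambda>q. kron_row Omega (axis k 1) $ (i, j) $ q * stack (vec_rows X) (vec_rows Y) $ q"
  have X: "?g (Inl i', l) = (if l = k then if i' = i then X $ i $ k else 0 else 0)" for i' l
    by (auto simp: kron_row_def Omega_def stack_def vec_rows_def axis_def)
  have Y: "?g (Inr j', l) = (if l = k then if j' = j then - Y $ j $ k else 0 else 0)" for j' l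
    by (auto simp: kron_row_def Omega_def stack_def vec_rows_def axis_def)
  have "(\<Sum>q\<in>UNIV. ?g q) = X $ i $ k - Y $ j $ k"
    unfolding * X Y by (simp add: sum.delta)
  then show ?thesis by (simp add: matrix_vector_mult_def)
qed

lemma cost_vec_nth:
  fixes X :: "real ^ 'd::finite ^ 'n::finite" and Y :: "real ^ 'd ^ 'm::finite"
  shows "cost_vec X Y $ (i, j) = (\<Sum>k\<in>UNIV. \<bar>X $ i $ k - Y $ j $ k\<bar>)"
proof -
  have *: "(scale_rows s A *v v) $ p = s $ p * (A *v v) $ p" for s :: "real ^ ('n \<times> 'm)"
    and A :: "real ^ (('n + 'm) \<times> 'd) ^ ('n \<times> 'm)" and v p
    by (simp add: scale_rows_def matrix_vector_mult_def sum_distrib_left mult.assoc)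
  have **: "(sum F UNIV *v v) $ p = (\<Sum>k\<in>UNIV. (F k *v v) $ p)"
    for F :: "'d \<Rightarrow> real ^ (('n + 'm) \<times> 'd) ^ ('n \<times> 'm)" and v p
  proof -
    have "(sum F T *v v) $ p = (\<Sum>k\<in>T. (F k *v v) $ p)" if "finite T" for T
      using that by (induction T) (simp_all add: matrix_vector_mult_add_rdistrib)
    then show ?thesis by simp
  qed
  show ?thesis
    by (simp add: cost_vec_def Theta_mul_def ** * sign_vec_def Omega_stack abs_sgn mult.commute)
qed

section \<open>Selective inference\<close>

text \<open>Throughout, \<open>\<M>\<close> maps data \<open>(X, Y)\<close> to the selected set of basic variables.  The basic
  solution is zero outside \<open>\<M>\<close>, so \<open>eta_mul\<close> is unaffected by the zero-padding.\<close>

definition selection_event ::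
    "(real ^ 'd ^ 'n \<Rightarrow> real ^ 'd ^ 'm \<Rightarrow> ('n \<times> 'm) set) \<Rightarrow>
     real ^ 'd ^ 'n \<Rightarrow> real ^ 'd ^ 'm \<Rightarrow>
     real ^ 'd::finite ^ 'n::finite \<Rightarrow> real ^ 'd ^ 'm::finite \<Rightarrow> bool" where
  "selection_event \<M> Xobs Yobs X Y \<longleftrightarrow>
     (\<forall>k. sign_vec k X Y = sign_vec k Xobs Yobs) \<and> \<M> X Y = \<M> Xobs Yobs"

definition eta_mul ::
    "(real ^ 'd ^ 'n \<Rightarrow> real ^ 'd ^ 'm::{finite,linorder} \<Rightarrow> ('n \<times> 'm) set) \<Rightarrow>
     real ^ 'd ^ 'n \<Rightarrow> real ^ 'd ^ 'm::{finite,linorder} \<Rightarrow>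
     real ^ (('n::finite + 'm::{finite,linorder}) \<times> 'd::finite)" where
  "eta_mul \<M> Xobs Yobs =
     transpose (restrict_rows (\<M> Xobs Yobs) (Theta_mul Xobs Yobs))
       *v basic_solution S_ot h_ot (\<M> Xobs Yobs)"

definition b_mul :: "real ^ 'k ^ 'k \<Rightarrow> real ^ 'k \<Rightarrow> real ^ 'k" where
  "b_mul \<Sigma> \<eta> = inverse (\<eta> \<bullet> (\<Sigma> *v \<eta>)) *\<^sub>R (\<Sigma> *v \<eta>)"

definition q_mul :: "real ^ 'k ^ 'k \<Rightarrow> real ^ 'k \<Rightarrow> real ^ 'k \<Rightarrow> real ^ 'k" where
  "q_mul \<Sigma> \<eta> v =
     (mat 1 - (columnvector (b_mul \<Sigma> \<eta>) :: real ^ 1 ^ 'k) ** rowvector \<eta>) *v v"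

definition Z_mul ::
    "(real ^ 'd ^ 'n \<Rightarrow> real ^ 'd ^ 'm::{finite,linorder} \<Rightarrow> ('n \<times> 'm) set) \<Rightarrow>
     real ^ 'd ^ 'n \<Rightarrow> real ^ 'd ^ 'm::{finite,linorder} \<Rightarrow>
     real ^ (('n + 'm) \<times> 'd) ^ (('n + 'm) \<times> 'd) \<Rightarrow>
     real ^ 'd ^ 'n \<Rightarrow> real ^ 'd ^ 'm::{finite,linorder} \<Rightarrow> real set" where
  "Z_mul \<M> Xobs Yobs \<Sigma> X Y =
     (let \<eta> = eta_mul \<M> Xobs Yobs;
          u = (\<lambda>z. q_mul \<Sigma> \<eta> (stack (vec_rows X) (vec_rows Y)) + z *\<^sub>R b_mul \<Sigma> \<eta>)
      in {z. selection_event \<M> Xobs Yobs (unstack_X (u z)) (unstack_Y (u z))})"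

definition C_sel_mul ::
    "real \<Rightarrow> (real ^ 'd ^ 'n \<Rightarrow> real ^ 'd ^ 'm::{finite,linorder} \<Rightarrow> ('n \<times> 'm) set) \<Rightarrow>
     real ^ 'd ^ 'n \<Rightarrow> real ^ 'd ^ 'm::{finite,linorder} \<Rightarrow>
     real ^ (('n + 'm) \<times> 'd) ^ (('n + 'm) \<times> 'd) \<Rightarrow>
     real ^ 'd ^ 'n \<Rightarrow> real ^ 'd ^ 'm::{finite,linorder} \<Rightarrow> real set" where
  "C_sel_mul \<alpha> \<M> Xobs Yobs \<Sigma> X Y =
     (let \<eta> = eta_mul \<M> Xobs Yobs;
          F = (\<lambda>w. truncated_normal_cdf (Z_mul \<M> Xobs Yobs \<Sigma> X Y) w (\<eta> \<bullet> (\<Sigma> *v \<eta>))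
                     (\<eta> \<bullet> stack (vec_rows X) (vec_rows Y)))
      in {w. \<alpha> / 2 \<le> F w \<and> F w \<le> 1 - \<alpha> / 2})"

end

(* Write V for the stacked vector, T = eta . V and Q = V - T b, so that V = Q + T b and the selection
   event reads T : Z(Q).  T and Q are independent, hence conditionally on Q the law of T on the
   selection event is the normal law N(W*, sigma^2) truncated to Z(Q), and by the probability integral
   transform its c.d.f. evaluated at T is uniform.  Averaging over Q gives the claim.

   Independence is obtained without characteristic functions: V is an affine image of a standard
   Gaussian z, and T depends on u . z only, Q on the projection of z orthogonal to u only, for a unit
   vector u.  Adding an independent standard normal coordinate t, the rotation exchanging u . z and t
   (up to sign) preserves the Gaussian law and the projection, so u . z may be resampled. *)

theory Submission
  imports Defs
begin

section \<open>Probability integral transform for continuous and truncated laws\<close>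

lemma (in real_distribution) cdf_attains:
  assumes cont: "\<And>x. isCont (cdf M) x" and "0 < c" "c < 1"
  shows "\<exists>x. cdf M x = c"
proof -
  have "eventually (\<lambda>x. cdf M x < c) at_bot"
    using cdf_lim_at_bot \<open>0 < c\<close> by (rule order_tendstoD)
  then obtain a where a: "\<And>x. x \<le> a \<Longrightarrow> cdf M x < c"
    by (auto simp: eventually_at_bot_linorder)
  have "eventually (\<lambda>x. c < cdf M x) at_top"
    using cdf_lim_at_top_prob \<open>c < 1\<close> by (rule order_tendstoD)
  then obtain b where b: "\<And>x. b \<le> x \<Longrightarrow> c < cdf M x"
    by (auto simp: eventually_at_top_linorder)
  have "a \<le> b"
    using a[of a] b[of a] by (cases "a \<le> b") auto
  then show ?thesis
    using IVT[of "cdf M" a c b] a[of a] b[of b] cont by auto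
qed

text \<open>A truncated c.d.f. is flat across gaps of the truncation set, so it has no inverse.
  Instead \<open>c\<close> is approached by levels \<open>d\<close> attained at some
  \<open>x\<close>, where the half-line \<open>{..x}\<close> has mass exactly \<open>d\<close>: the
  strict sublevel set is bounded from below, the weak one from above.\<close>

lemma (in real_distribution) prob_cdf_transform:
  assumes cont: "\<And>x. isCont (cdf M) x" and c: "0 < c" "c < 1"
  shows "prob {x. cdf M x < c} = c" and "prob {x. cdf M x \<le> c} = c"
proof -
  have [measurable]: "cdf M \<in> borel_measurable borel"
    by (intro borel_measurable_mono monoI cdf_nondecreasing)
  have meas[measurable]: "{x. cdf M x < c} \<in> events" "{x. cdf M x \<le> c} \<in> events"
    by simp_all
  have lower: "d \<le> prob {x. cdf M x < c}" if "d < c" for d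
  proof (cases "0 < d")
    case True
    then obtain x where x: "cdf M x = d"
      using cdf_attains[OF cont] \<open>d < c\<close> c by force
    have "{..x} \<subseteq> {x. cdf M x < c}"
      using cdf_nondecreasing[of _ x] x \<open>d < c\<close> by force
    then have "prob {..x} \<le> prob {x. cdf M x < c}"
      by (intro finite_measure_mono) simp_all
    then show ?thesis using x by (simp add: cdf_def)
  qed (use measure_nonneg[of M "{x. cdf M x < c}"] in linarith)
  have upper: "prob {x. cdf M x \<le> c} \<le> d" if "c < d" for d
  proof (cases "d < 1")
    case True
    then obtain x where x: "cdf M x = d"
      using cdf_attains[OF cont] \<open>c < d\<close> c by force
    have "{x. cdf M x \<le> c} \<subseteq> {..x}"
    proof
      fix y assume "y \<in> {x. cdf M x \<le> c}"
      then show "y \<in> {..x}"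
        using cdf_nondecreasing[of x y] x \<open>c < d\<close> by (cases "y \<le> x") auto
    qed
    then have "prob {x. cdf M x \<le> c} \<le> prob {..x}"
      by (intro finite_measure_mono) simp_all
    then show ?thesis using x by (simp add: cdf_def)
  qed (use prob_le_1[of "{x. cdf M x \<le> c}"] in linarith)
  have "prob {x. cdf M x < c} \<le> prob {x. cdf M x \<le> c}"
    by (intro finite_measure_mono) auto
  then show "prob {x. cdf M x < c} = c" "prob {x. cdf M x \<le> c} = c"
    using dense_ge[of c "prob {x. cdf M x \<le> c}", OF upper] dense_le[of c "prob {x. cdf M x < c}", OF lower]
    by linarith+
qed

text \<open>The closed band is a weak sublevel set minus a strict one, hence both forms of the
  transform. For \<alpha> = 0 the levels 0 and 1 are outside its range, but the band is
  everything.\<close>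

lemma (in real_distribution) prob_cdf_central:
  assumes cont: "\<And>x. isCont (cdf M) x" and \<alpha>: "0 \<le> \<alpha>" "\<alpha> \<le> 1"
  shows "prob {x. \<alpha> / 2 \<le> cdf M x \<and> cdf M x \<le> 1 - \<alpha> / 2} = 1 - \<alpha>"
proof (cases "\<alpha> = 0")
  case True
  then show ?thesis
    using prob_space by (simp add: cdf_nonneg cdf_bounded_prob)
next
  case False
  have [measurable]: "cdf M \<in> borel_measurable borel"
    by (intro borel_measurable_mono monoI cdf_nondecreasing)
  have [measurable]: "{x. cdf M x < a} \<in> events" "{x. cdf M x \<le> a} \<in> events" for a
    by simp_all
  have "{x. \<alpha> / 2 \<le> cdf M x \<and> cdf M x \<le> 1 - \<alpha> / 2} =
      {x. cdf M x \<le> 1 - \<alpha> / 2} - {x. cdf M x < \<alpha> / 2}"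
    by auto
  moreover have "prob \<dots> = prob {x. cdf M x \<le> 1 - \<alpha> / 2} - prob {x. cdf M x < \<alpha> / 2}"
    using \<alpha> by (intro finite_measure_Diff) auto
  ultimately show ?thesis
    using prob_cdf_transform[OF cont, of "\<alpha> / 2"] prob_cdf_transform[OF cont, of "1 - \<alpha> / 2"] \<alpha> False
    by simp
qed

text \<open>Multiplying the conditional statement by the mass of \<open>Z\<close> yields an identity
  that also covers null \<open>Z\<close>, where both sides vanish. It can then be integrated over
  all slices.\<close>

lemma emeasure_truncated_cdf_central:
  fixes G :: "real measure" and Z :: "real set"
  assumes G: "real_distribution G" and atomless: "\<And>x. emeasure G {x} = 0"
    and Z[measurable]: "Z \<in> sets borel" and \<alpha>: "0 \<le> \<alpha>" "\<alpha> \<le> 1"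
  defines "F \<equiv> cdf (uniform_measure G Z)"
  shows "emeasure G {x \<in> Z. \<alpha> / 2 \<le> F x \<and> F x \<le> 1 - \<alpha> / 2} = ennreal (1 - \<alpha>) * emeasure G Z"
proof -
  interpret G: real_distribution G by fact
  let ?D = "{x. \<alpha> / 2 \<le> F x \<and> F x \<le> 1 - \<alpha> / 2}"
  have split: "{x \<in> Z. \<alpha> / 2 \<le> F x \<and> F x \<le> 1 - \<alpha> / 2} = Z \<inter> ?D"
    by auto
  show ?thesis
  proof (cases "emeasure G Z = 0")
    case True
    have "emeasure G (Z \<inter> ?D) \<le> emeasure G Z"
      by (intro emeasure_mono) auto
    then show ?thesis
      using True unfolding split by simp
  next
    case False
    have fin: "emeasure G Z \<noteq> \<infinity>" by simp
    interpret U: real_distribution "uniform_measure G Z"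
      using prob_space_uniform_measure[OF False fin]
      by (simp add: real_distribution_def real_distribution_axioms_def)
    have F[measurable]: "F \<in> borel_measurable borel"
      unfolding F_def by (intro borel_measurable_mono monoI U.cdf_nondecreasing)
    have D[measurable]: "?D \<in> sets borel"
      by measurable
    \<comment> \<open>Null points make the truncated c.d.f. continuous, as the band lemma
      requires.\<close>
    have "measure (uniform_measure G Z) {x} = 0" for x
    proof -
      have "emeasure G (Z \<inter> {x}) \<le> emeasure G {x}"
        by (intro emeasure_mono) auto
      then show ?thesis
        using atomless by (simp add: measure_def)
    qed
    then have "emeasure (uniform_measure G Z) ?D = ennreal (1 - \<alpha>)"
      unfolding U.emeasure_eq_measure F_def
      by (subst U.prob_cdf_central) (use \<alpha> in \<open>auto simp: U.isCont_cdf\<close>)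
    then have "emeasure G (Z \<inter> ?D) / emeasure G Z = ennreal (1 - \<alpha>)"
      by simp
    then have "ennreal (1 - \<alpha>) * emeasure G Z = emeasure G (Z \<inter> ?D) / emeasure G Z * emeasure G Z"
      by simp
    also have "\<dots> = emeasure G (Z \<inter> ?D) * emeasure G Z / emeasure G Z"
      by (simp only: ennreal_times_divide mult.commute)
    also have "\<dots> = emeasure G (Z \<inter> ?D)"
      using False fin by (intro ennreal_mult_divide_eq) simp_all
    finally have "emeasure G (Z \<inter> ?D) = ennreal (1 - \<alpha>) * emeasure G Z" ..
    then show ?thesis
      unfolding split .
  qed
qed

section \<open>Shears and rotations preserve Lebesgue measure\<close>

lemma nn_integral_lborel_translate:
  fixes f :: "'a::euclidean_space \<Rightarrow> ennreal"
  assumes [measurable]: "f \<in> borel_measurable borel"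
  shows "(\<integral>\<^sup>+x. f (x + c) \<partial>lborel) = (\<integral>\<^sup>+x. f x \<partial>lborel)"
proof -
  have "(\<integral>\<^sup>+x. f x \<partial>lborel) = (\<integral>\<^sup>+x. f x \<partial>distr lborel borel ((+) c))"
    by (simp add: lborel_distr_plus)
  then show ?thesis
    by (simp add: nn_integral_distr add.commute)
qed

text \<open>Tonelli with the sheared coordinate integrated first: for fixed \<open>y\<close> the
  shear is a translation by the constant \<open>h y\<close>.\<close>

lemma nn_integral_lborel_shear_fst:
  fixes f :: "'a::euclidean_space \<times> 'b::euclidean_space \<Rightarrow> ennreal" and h :: "'b \<Rightarrow> 'a"
  assumes [measurable]: "f \<in> borel_measurable borel" "h \<in> borel_measurable borel"
  shows "(\<integral>\<^sup>+(x, y). f (x + h y, y) \<partial>lborel) = (\<integral>\<^sup>+p. f p \<partial>lborel)"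
proof -
  have f[measurable]: "f \<in> borel_measurable (borel \<Otimes>\<^sub>M borel)"
    by (simp add: borel_prod)
  have "(\<integral>\<^sup>+(x, y). f (x + h y, y) \<partial>lborel) = (\<integral>\<^sup>+y. \<integral>\<^sup>+x. f (x + h y, y) \<partial>lborel \<partial>lborel)"
    unfolding lborel_prod[symmetric] by (subst lborel_pair.nn_integral_snd[symmetric]) simp_all
  also have "\<dots> = (\<integral>\<^sup>+y. \<integral>\<^sup>+x. f (x, y) \<partial>lborel \<partial>lborel)"
    by (intro nn_integral_cong nn_integral_lborel_translate[of "\<lambda>x. f (x, _)"]) simp
  also have "\<dots> = (\<integral>\<^sup>+p. f p \<partial>lborel)"
    unfolding lborel_prod[symmetric] by (subst lborel_pair.nn_integral_snd) simp_all
  finally show ?thesis .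
qed

lemma nn_integral_lborel_shear_snd:
  fixes f :: "'a::euclidean_space \<times> 'b::euclidean_space \<Rightarrow> ennreal" and h :: "'a \<Rightarrow> 'b"
  assumes [measurable]: "f \<in> borel_measurable borel" "h \<in> borel_measurable borel"
  shows "(\<integral>\<^sup>+(x, y). f (x, y + h x) \<partial>lborel) = (\<integral>\<^sup>+p. f p \<partial>lborel)"
proof -
  have f[measurable]: "f \<in> borel_measurable (borel \<Otimes>\<^sub>M borel)"
    by (simp add: borel_prod)
  have "(\<integral>\<^sup>+(x, y). f (x, y + h x) \<partial>lborel) = (\<integral>\<^sup>+x. \<integral>\<^sup>+y. f (x, y + h x) \<partial>lborel \<partial>lborel)"
    unfolding lborel_prod[symmetric] by (subst lborel.nn_integral_fst[symmetric]) simp_all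
  also have "\<dots> = (\<integral>\<^sup>+x. \<integral>\<^sup>+y. f (x, y) \<partial>lborel \<partial>lborel)"
    by (intro nn_integral_cong nn_integral_lborel_translate[of "\<lambda>y. f (_, y)"]) simp
  also have "\<dots> = (\<integral>\<^sup>+p. f p \<partial>lborel)"
    unfolding lborel_prod[symmetric] by (subst lborel.nn_integral_fst) simp_all
  finally show ?thesis .
qed

text \<open>A rotation by a right angle in the plane spanned by \<open>u\<close> and the extra real coordinate is a
  product of three shears.\<close>

lemma nn_integral_lborel_rotate:
  fixes f :: "'a::euclidean_space \<times> real \<Rightarrow> ennreal"
  assumes f[measurable]: "f \<in> borel_measurable borel" and u: "norm u = 1"
  shows "(\<integral>\<^sup>+(z, t). f (z - (u \<bullet> z) *\<^sub>R u + t *\<^sub>R u, - (u \<bullet> z)) \<partial>lborel) = (\<integral>\<^sup>+p. f p \<partial>lborel)"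
proof -
  have [simp]: "u \<bullet> u = 1"
    using u by (simp add: norm_eq_1)
  have [measurable]: "f \<in> borel_measurable (borel \<Otimes>\<^sub>M borel)"
    by (simp add: borel_prod)
  define S where "S = (\<lambda>(z, t::real). (z + t *\<^sub>R u, t))"
  define T where "T = (\<lambda>(z, t::real). (z, t + - (u \<bullet> z)))"
  have [measurable]: "S \<in> borel_measurable borel" "T \<in> borel_measurable borel"
    unfolding S_def T_def borel_prod[symmetric] by simp_all
  have S: "(\<integral>\<^sup>+p. g (S p) \<partial>lborel) = (\<integral>\<^sup>+p. g p \<partial>lborel)" if "g \<in> borel_measurable borel" for g
    using nn_integral_lborel_shear_fst[OF that, of "\<lambda>t. t *\<^sub>R u"] by (simp add: S_def case_prod_unfold)
  have T: "(\<integral>\<^sup>+p. g (T p) \<partial>lborel) = (\<integral>\<^sup>+p. g p \<partial>lborel)" if "g \<in> borel_measurable borel" for g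
    using nn_integral_lborel_shear_snd[OF that, of "\<lambda>z. - (u \<bullet> z)"] by (simp add: T_def case_prod_unfold)
  \<comment> \<open>Since \<open>u \<bullet> u = 1\<close>, the shears send (z, t) to (z + t u, t),
    then to (z + t u, -(u \<bullet> z)), then to the rotated pair. They are removed one at a time,
    starting with the one applied first.\<close>
  have "(\<integral>\<^sup>+(z, t). f (z - (u \<bullet> z) *\<^sub>R u + t *\<^sub>R u, - (u \<bullet> z)) \<partial>lborel)
      = (\<integral>\<^sup>+p. f (S (T (S p))) \<partial>lborel)"
    by (intro nn_integral_cong) (auto simp: S_def T_def inner_add_right algebra_simps)
  also have "\<dots> = (\<integral>\<^sup>+p. f (S (T p)) \<partial>lborel)"
    by (rule S) simp
  also have "\<dots> = (\<integral>\<^sup>+p. f (S p) \<partial>lborel)"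
    by (rule T) simp
  also have "\<dots> = (\<integral>\<^sup>+p. f p \<partial>lborel)"
    by (rule S) simp
  finally show ?thesis .
qed

section \<open>The standard Gaussian measure and resampling along one direction\<close>

text \<open>Stated on any Euclidean space so that vectors, the extra real coordinate and pairs of
  vectors are treated alike; written through the norm so that rotation invariance is
  immediate.\<close>

definition gaussian_kernel :: "'a::euclidean_space \<Rightarrow> real" where
  "gaussian_kernel z = (1 / sqrt (2 * pi)) ^ DIM('a) * exp (- (norm z)\<^sup>2 / 2)"

definition std_gaussian :: "'a::euclidean_space measure" where
  "std_gaussian = density lborel (\<lambda>z. ennreal (gaussian_kernel z))"

lemma gaussian_kernel_nonneg [simp]: "0 \<le> gaussian_kernel z"
  by (simp add: gaussian_kernel_def)

lemma borel_measurable_gaussian_kernel [measurable]: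
  "gaussian_kernel \<in> borel_measurable borel"
  unfolding gaussian_kernel_def by measurable

lemma sets_std_gaussian [simp, measurable_cong]: "sets std_gaussian = sets borel"
  and space_std_gaussian [simp]: "space std_gaussian = UNIV"
  by (simp_all add: std_gaussian_def)

lemma gaussian_kernel_real: "gaussian_kernel (t :: real) = std_normal_density t"
  by (simp add: gaussian_kernel_def std_normal_density_def)

lemma gaussian_kernel_Pair: "gaussian_kernel (x, y) = gaussian_kernel x * gaussian_kernel y"
  by (simp add: gaussian_kernel_def norm_Pair power_add add_divide_distrib exp_add[symmetric])

lemma std_gaussian_vec: "(std_gaussian :: (real ^ 'k) measure) = std_normal_vec"
proof -
  have "gaussian_kernel z = (\<Prod>i\<in>UNIV. std_normal_density (z $ i))" for z :: "real ^ 'k"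
  proof -
    have "- (norm z)\<^sup>2 / 2 = (\<Sum>i\<in>UNIV. - (z $ i)\<^sup>2 / 2)"
      by (simp add: power2_norm_eq_inner inner_vec_def sum_negf sum_divide_distrib flip: power2_eq_square)
    then show ?thesis
      by (simp add: gaussian_kernel_def std_normal_density_def prod_dividef exp_sum power_divide)
  qed
  then show ?thesis
    by (simp add: std_gaussian_def std_normal_vec_def)
qed

lemma sigma_finite_std_gaussian: "sigma_finite_measure std_gaussian"
  unfolding std_gaussian_def by (subst sigma_finite_measure.sigma_finite_iff_density_finite[OF sigma_finite_lborel]) simp_all

lemma std_gaussian_prod:
  "std_gaussian \<Otimes>\<^sub>M std_gaussian = (std_gaussian :: ('a::euclidean_space \<times> 'b::euclidean_space) measure)"
proof -
  have "density lborel (\<lambda>x::'a. ennreal (gaussian_kernel x)) \<Otimes>\<^sub>M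
      density lborel (\<lambda>y::'b. ennreal (gaussian_kernel y)) =
      density lborel (\<lambda>(x, y). ennreal (gaussian_kernel x) * ennreal (gaussian_kernel y))"
    using sigma_finite_std_gaussian[where 'a='b] unfolding std_gaussian_def
    by (subst pair_measure_density) (simp_all add: lborel_prod sigma_finite_lborel)
  also have "(\<lambda>(x, y). ennreal (gaussian_kernel x) * ennreal (gaussian_kernel y)) =
      (\<lambda>z :: 'a \<times> 'b. ennreal (gaussian_kernel z))"
    by (auto simp: gaussian_kernel_Pair ennreal_mult)
  finally show ?thesis
    unfolding std_gaussian_def .
qed

text \<open>The rotation carries an auxiliary coordinate \<open>t\<close> into the place of
  \<open>u \<bullet> z\<close> and keeps the projection of \<open>z\<close> orthogonal to
  \<open>u\<close>. This expresses the independence of the two parts as an identity of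
  integrals.\<close>

lemma std_gaussian_resample_direction:
  fixes g :: "real \<times> 'a::euclidean_space \<Rightarrow> ennreal"
  assumes [measurable]: "g \<in> borel_measurable borel" and u: "norm u = 1"
  shows "(\<integral>\<^sup>+z. g (u \<bullet> z, z - (u \<bullet> z) *\<^sub>R u) \<partial>std_gaussian) =
    (\<integral>\<^sup>+z. \<integral>\<^sup>+t. g (t, z - (u \<bullet> z) *\<^sub>R u) \<partial>std_gaussian \<partial>std_gaussian)"
proof -
  have [simp]: "u \<bullet> u = 1"
    using u by (simp add: norm_eq_1)
  have [measurable]: "g \<in> borel_measurable (borel \<Otimes>\<^sub>M borel)"
    by (simp add: borel_prod)
  interpret \<gamma>: prob_space "std_gaussian :: real measure"
    using prob_space_normal_density[of 1 0] by (simp add: std_gaussian_def gaussian_kernel_real)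
  let ?\<gamma> = "std_gaussian :: ('a \<times> real) measure"
  let ?k = "\<lambda>(z, t :: real). g (u \<bullet> z, z - (u \<bullet> z) *\<^sub>R u) :: ennreal"
  let ?R = "\<lambda>(z, t). (z - (u \<bullet> z) *\<^sub>R u + t *\<^sub>R u, - (u \<bullet> z))"
  \<comment> \<open>The rotation preserves the norm of the pair, and the kernel depends on the norm
    only.\<close>
  have kernel: "gaussian_kernel (?R p) = gaussian_kernel p" for p :: "'a \<times> real"
  proof (cases p)
    case (Pair z t)
    have "(norm (?R p))\<^sup>2 = (norm p)\<^sup>2"
      unfolding Pair
      by (simp add: power2_norm_eq_inner inner_diff_left inner_diff_right inner_add_left
          inner_add_right inner_commute algebra_simps)
    then show ?thesis
      by (simp add: gaussian_kernel_def)
  qed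
  \<comment> \<open>After the rotation the component along \<open>u\<close> is \<open>t\<close>;
    subtracting it leaves the projection of the original \<open>z\<close>.\<close>
  have k: "?k (?R (z, t)) = g (t, z - (u \<bullet> z) *\<^sub>R u)" for z and t :: real
    by (simp add: inner_diff_right inner_add_right)
  have k_meas: "?k \<in> borel_measurable borel"
    "(\<lambda>(z, t :: real). g (t, z - (u \<bullet> z) *\<^sub>R u)) \<in> borel_measurable borel"
    unfolding borel_prod[symmetric] by measurable
  \<comment> \<open>The integrand is constant in the added coordinate \<open>t\<close>, whose law
    has mass one.\<close>
  have "(\<integral>\<^sup>+z. g (u \<bullet> z, z - (u \<bullet> z) *\<^sub>R u) \<partial>std_gaussian) =
      (\<integral>\<^sup>+z. \<integral>\<^sup>+t. ?k (z, t) \<partial>std_gaussian \<partial>std_gaussian)"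
    using \<gamma>.emeasure_space_1 by simp
  also have "\<dots> = (\<integral>\<^sup>+p. ?k p \<partial>?\<gamma>)"
    by (subst \<gamma>.nn_integral_fst) (use k_meas in \<open>simp_all add: std_gaussian_prod\<close>)
  also have "\<dots> = (\<integral>\<^sup>+p. gaussian_kernel p * ?k p \<partial>lborel)"
    unfolding std_gaussian_def by (subst nn_integral_density) (use k_meas in simp_all)
  also have "\<dots> = (\<integral>\<^sup>+(z, t). gaussian_kernel (?R (z, t)) * ?k (?R (z, t)) \<partial>lborel)"
    using k_meas by (subst nn_integral_lborel_rotate[OF _ u, symmetric]) (simp_all add: case_prod_unfold)
  also have "\<dots> = (\<integral>\<^sup>+(z, t). gaussian_kernel (z, t) * g (t, z - (u \<bullet> z) *\<^sub>R u) \<partial>lborel)"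
    unfolding kernel k ..
  also have "\<dots> = (\<integral>\<^sup>+(z, t). g (t, z - (u \<bullet> z) *\<^sub>R u) \<partial>?\<gamma>)"
    unfolding std_gaussian_def
    by (subst nn_integral_density) (use k_meas in \<open>simp_all add: case_prod_unfold\<close>)
  also have "\<dots> = (\<integral>\<^sup>+z. \<integral>\<^sup>+t. g (t, z - (u \<bullet> z) *\<^sub>R u) \<partial>std_gaussian \<partial>std_gaussian)"
    by (subst std_gaussian_prod[symmetric], subst \<gamma>.nn_integral_fst[symmetric]) simp_all
  finally show ?thesis .
qed

section \<open>Affine images of Gaussians and the truncated pivot\<close>

text \<open>Here \<open>a\<close> is the adjoint of \<open>L\<close> applied to
  \<open>\<eta>\<close>, so \<open>\<eta> \<bullet> V z\<close> is an affine function of the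
  component of \<open>z\<close> along \<open>a\<close>. The vector \<open>b\<close> is chosen so
  that the residual sees only the part of \<open>z\<close> orthogonal to \<open>a\<close>;
  resampling then applies.\<close>

lemma std_gaussian_linear_image_split:
  fixes L :: "'a::euclidean_space \<Rightarrow> 'b::euclidean_space" and g :: "real \<times> 'b \<Rightarrow> ennreal" and \<mu> :: 'b
  assumes L: "linear L" and adj: "\<And>z. \<eta> \<bullet> L z = a \<bullet> z" and a: "a \<noteq> 0"
    and [measurable]: "g \<in> borel_measurable borel"
  defines "V \<equiv> \<lambda>z. \<mu> + L z" and "b \<equiv> inverse (a \<bullet> a) *\<^sub>R L a"
  shows "(\<integral>\<^sup>+z. g (\<eta> \<bullet> V z, V z - (\<eta> \<bullet> V z) *\<^sub>R b) \<partial>std_gaussian) =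
    (\<integral>\<^sup>+z. \<integral>\<^sup>+s. g (s, V z - (\<eta> \<bullet> V z) *\<^sub>R b)
      \<partial>density lborel (\<lambda>x. ennreal (normal_density (\<eta> \<bullet> \<mu>) (norm a) x)) \<partial>std_gaussian)"
proof -
  have [measurable]: "g \<in> borel_measurable (borel \<Otimes>\<^sub>M borel)"
    by (simp add: borel_prod)
  have [measurable]: "L \<in> borel_measurable borel"
    using L by (intro borel_measurable_continuous_onI linear_continuous_on linear_conv_bounded_linear[THEN iffD1])
  define u where "u = a /\<^sub>R norm a"
  have u: "norm u = 1" and au: "a = norm a *\<^sub>R u"
    using a by (simp_all add: u_def)
  define m where "m = \<mu> - (\<eta> \<bullet> \<mu>) *\<^sub>R b"
  define g' where "g' = (\<lambda>(t, z). g (\<eta> \<bullet> \<mu> + norm a * t, m + L z))"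
  have [measurable]: "g' \<in> borel_measurable borel"
    unfolding g'_def borel_prod[symmetric] by measurable
  have T: "\<eta> \<bullet> V z = \<eta> \<bullet> \<mu> + norm a * (u \<bullet> z)" for z
    by (simp add: V_def inner_add_right adj) (subst au, simp)
  \<comment> \<open>Since \<open>b\<close> is \<open>L u\<close> divided by \<open>norm a\<close>,
    the multiple of \<open>b\<close> cancels \<open>L\<close> of the component along
    \<open>u\<close>; \<open>m\<close> collects the constants.\<close>
  have Q: "V z - (\<eta> \<bullet> V z) *\<^sub>R b = m + L (z - (u \<bullet> z) *\<^sub>R u)" for z
  proof -
    have "b = inverse (norm a) *\<^sub>R L u"
      unfolding b_def u_def using a linear_scale[OF L]
      by (simp add: dot_square_norm power2_eq_square)
    then have "(norm a * (u \<bullet> z)) *\<^sub>R b = L ((u \<bullet> z) *\<^sub>R u)"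
      using a linear_scale[OF L] by simp
    then show ?thesis
      unfolding T by (simp add: V_def m_def linear_diff[OF L] scaleR_add_left)
  qed
  \<comment> \<open>The substitution \<open>s = \<eta> \<bullet> \<mu> + norm a * t\<close>
    standardises the normal law; its Jacobian cancels the factor 1 / \<open>norm a\<close> of the
    density.\<close>
  have affine: "(\<integral>\<^sup>+s. g (s, y) \<partial>density lborel (\<lambda>x. ennreal (normal_density (\<eta> \<bullet> \<mu>) (norm a) x))) =
      (\<integral>\<^sup>+t. g (\<eta> \<bullet> \<mu> + norm a * t, y) \<partial>std_gaussian)" for y
  proof -
    have "(\<integral>\<^sup>+s. g (s, y) \<partial>density lborel (\<lambda>x. ennreal (normal_density (\<eta> \<bullet> \<mu>) (norm a) x))) =
        (\<integral>\<^sup>+s. ennreal (normal_density (\<eta> \<bullet> \<mu>) (norm a) s) * g (s, y) \<partial>lborel)"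
      by (subst nn_integral_density) simp_all
    also have "\<dots> = (\<integral>\<^sup>+t. ennreal (norm a) * (ennreal (normal_density (\<eta> \<bullet> \<mu>) (norm a) (\<eta> \<bullet> \<mu> + norm a * t)) *
        g (\<eta> \<bullet> \<mu> + norm a * t, y)) \<partial>lborel)"
      using a by (subst nn_integral_real_affine[where c="norm a" and t="\<eta> \<bullet> \<mu>"])
        (simp_all add: nn_integral_cmult)
    also have "\<dots> = (\<integral>\<^sup>+t. ennreal (gaussian_kernel t) * g (\<eta> \<bullet> \<mu> + norm a * t, y) \<partial>lborel)"
    proof (intro nn_integral_cong)
      fix t
      have "norm a * normal_density (\<eta> \<bullet> \<mu>) (norm a) (\<eta> \<bullet> \<mu> + norm a * t) = gaussian_kernel t"
        using a by (simp add: gaussian_kernel_real normal_density_def power_mult_distrib real_sqrt_mult)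
      then show "ennreal (norm a) * (ennreal (normal_density (\<eta> \<bullet> \<mu>) (norm a) (\<eta> \<bullet> \<mu> + norm a * t)) *
          g (\<eta> \<bullet> \<mu> + norm a * t, y)) = ennreal (gaussian_kernel t) * g (\<eta> \<bullet> \<mu> + norm a * t, y)"
        by (metis mult.assoc ennreal_mult norm_ge_zero normal_density_nonneg)
    qed
    also have "\<dots> = (\<integral>\<^sup>+t. g (\<eta> \<bullet> \<mu> + norm a * t, y) \<partial>std_gaussian)"
      unfolding std_gaussian_def by (subst nn_integral_density) simp_all
    finally show ?thesis .
  qed
  show ?thesis
    unfolding affine unfolding Q unfolding T
    using std_gaussian_resample_direction[OF \<open>g' \<in> borel_measurable borel\<close> u] by (simp add: g'_def)
qed

text \<open>The truncation set is the slice of the selection region \<open>B\<close> along the line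
  through the residual in direction \<open>b\<close>. Given the residual, the statistic is normal
  and selection restricts it to this slice, so the probability integral transform applies slice by
  slice. The product form allows averaging over null slices too.\<close>

lemma gaussian_truncated_pivot:
  fixes L :: "'a::euclidean_space \<Rightarrow> 'b::euclidean_space" and V :: "'w \<Rightarrow> 'b" and \<mu> :: 'b
  assumes P: "prob_space P" and V[measurable]: "V \<in> borel_measurable P"
    and law: "distr P borel V = distr std_gaussian borel (\<lambda>z. \<mu> + L z)"
    and L: "linear L" and adj: "\<And>z. \<eta> \<bullet> L z = a \<bullet> z" and a: "a \<noteq> 0"
    and b: "b = inverse (a \<bullet> a) *\<^sub>R L a"
    and B[measurable]: "B \<in> sets borel"
    and \<alpha>: "0 \<le> \<alpha>" "\<alpha> \<le> 1"
  defines "F \<equiv> \<lambda>v. truncated_normal_cdf {z. v - (\<eta> \<bullet> v) *\<^sub>R b + z *\<^sub>R b \<in> B}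
      (\<eta> \<bullet> \<mu>) (a \<bullet> a) (\<eta> \<bullet> v)"
  shows "\<P>(\<omega> in P. (\<alpha> / 2 \<le> F (V \<omega>) \<and> F (V \<omega>) \<le> 1 - \<alpha> / 2) \<and> V \<omega> \<in> B) =
    (1 - \<alpha>) * \<P>(\<omega> in P. V \<omega> \<in> B)"
proof -
  interpret P: prob_space P by fact
  define G where "G = density lborel (\<lambda>x. ennreal (normal_density (\<eta> \<bullet> \<mu>) (norm a) x))"
  interpret G: real_distribution G
    using prob_space_normal_density[of "norm a" "\<eta> \<bullet> \<mu>"] a
    by (simp add: G_def real_distribution_def real_distribution_axioms_def)
  have atomless: "emeasure G {x} = 0" for x
    unfolding G_def by (subst emeasure_density)
      (auto simp: nn_integral_0_iff_AE intro!: AE_I[of _ _ "{x}"] split: split_indicator)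
  have sqrt_v: "sqrt (a \<bullet> a) = norm a"
    by (simp add: norm_eq_sqrt_inner)
  \<comment> \<open>The slice is determined by the residual \<open>y\<close>, so the truncated
    c.d.f. is a function of the statistic \<open>s\<close> and \<open>y\<close> alone.\<close>
  define H where "H = (\<lambda>(s, y). cdf (uniform_measure G {z. y + z *\<^sub>R b \<in> B}) s)"
  have F_H: "F v = H (\<eta> \<bullet> v, v - (\<eta> \<bullet> v) *\<^sub>R b)" for v
    by (simp add: F_def H_def truncated_normal_cdf_def G_def sqrt_v)
  have slice[measurable]: "{z. y + z *\<^sub>R b \<in> B} \<in> sets borel" for y
    by measurable
  \<comment> \<open>A quotient of two integrals with parameters \<open>s\<close> and
    \<open>y\<close> is jointly measurable, by the measurability part of Tonelli.\<close>
  have H[measurable]: "H \<in> borel_measurable (borel \<Otimes>\<^sub>M borel)"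
  proof -
    have "H = (\<lambda>(s, y). enn2real ((\<integral>\<^sup>+z. (if z \<le> s then indicator B (y + z *\<^sub>R b) else 0) \<partial>G) /
        (\<integral>\<^sup>+z. indicator B (y + z *\<^sub>R b) \<partial>G)))"
    proof (intro ext, clarify)
      fix s y
      let ?Z = "{z. y + z *\<^sub>R b \<in> B}"
      have "(\<integral>\<^sup>+z. (if z \<le> s then indicator B (y + z *\<^sub>R b) else 0) \<partial>G) =
          (\<integral>\<^sup>+z. indicator (?Z \<inter> {..s}) z \<partial>G)"
        by (intro nn_integral_cong) (auto split: split_indicator)
      also have "\<dots> = emeasure G (?Z \<inter> {..s})"
        by (rule nn_integral_indicator) simp
      moreover have "(\<integral>\<^sup>+z. indicator B (y + z *\<^sub>R b) \<partial>G) = (\<integral>\<^sup>+z. indicator ?Z z \<partial>G)"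
        by (intro nn_integral_cong) (auto split: split_indicator)
      moreover have "\<dots> = emeasure G ?Z"
        by (rule nn_integral_indicator) simp
      ultimately show "H (s, y) = enn2real
          ((\<integral>\<^sup>+z. (if z \<le> s then indicator B (y + z *\<^sub>R b) else 0) \<partial>G) /
           (\<integral>\<^sup>+z. indicator B (y + z *\<^sub>R b) \<partial>G))"
        by (simp add: H_def cdf_def measure_def)
    qed
    also have "\<dots> \<in> borel_measurable (borel \<Otimes>\<^sub>M borel)"
      by measurable
    finally show ?thesis .
  qed
  define D where "D = {p. \<alpha> / 2 \<le> H p \<and> H p \<le> 1 - \<alpha> / 2}"
  have D[measurable]: "D \<in> sets (borel \<Otimes>\<^sub>M borel)"
  proof -
    have "D = {p \<in> space (borel \<Otimes>\<^sub>M borel). \<alpha> / 2 \<le> H p \<and> H p \<le> 1 - \<alpha> / 2}"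
      by (simp add: D_def space_pair_measure)
    then show ?thesis by simp
  qed
  have [measurable]: "L \<in> borel_measurable borel"
    using L by (intro borel_measurable_continuous_onI linear_continuous_on linear_conv_bounded_linear[THEN iffD1])
  define q where "q = (\<lambda>z. \<mu> + L z - (\<eta> \<bullet> (\<mu> + L z)) *\<^sub>R b)"
  \<comment> \<open>The statistic becomes a fresh normal \<open>s\<close>, the residual stays
    \<open>q z\<close>, and selection becomes membership of \<open>s\<close> in the slice. It is
    applied with \<open>A = D\<close> for coverage and with \<open>A = UNIV\<close> for selection
    alone.\<close>
  have disintegrate: "emeasure P {\<omega> \<in> space P. (\<eta> \<bullet> V \<omega>, V \<omega> - (\<eta> \<bullet> V \<omega>) *\<^sub>R b) \<in> A \<and> V \<omega> \<in> B} =
      (\<integral>\<^sup>+z. emeasure G {s \<in> {s. q z + s *\<^sub>R b \<in> B}. (s, q z) \<in> A} \<partial>std_gaussian)"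
    if A[measurable]: "A \<in> sets (borel \<Otimes>\<^sub>M borel)" for A :: "(real \<times> 'b) set"
  proof -
    \<comment> \<open>The argument of \<open>B\<close> reassembles the sample from residual and
      statistic.\<close>
    define g :: "real \<times> 'b \<Rightarrow> ennreal" where "g = (\<lambda>(s, y). indicator A (s, y) * indicator B (y + s *\<^sub>R b))"
    have g[measurable]: "g \<in> borel_measurable (borel \<Otimes>\<^sub>M borel)"
      unfolding g_def by measurable
    define f where "f = (\<lambda>v. g (\<eta> \<bullet> v, v - (\<eta> \<bullet> v) *\<^sub>R b))"
    have f[measurable]: "f \<in> borel_measurable borel"
      unfolding f_def by measurable
    have "emeasure P {\<omega> \<in> space P. (\<eta> \<bullet> V \<omega>, V \<omega> - (\<eta> \<bullet> V \<omega>) *\<^sub>R b) \<in> A \<and> V \<omega> \<in> B} =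
        (\<integral>\<^sup>+\<omega>. indicator {\<omega> \<in> space P. (\<eta> \<bullet> V \<omega>, V \<omega> - (\<eta> \<bullet> V \<omega>) *\<^sub>R b) \<in> A \<and> V \<omega> \<in> B} \<omega> \<partial>P)"
      by (rule nn_integral_indicator[symmetric]) measurable
    also have "\<dots> = (\<integral>\<^sup>+\<omega>. f (V \<omega>) \<partial>P)"
      by (intro nn_integral_cong) (auto simp: f_def g_def split: split_indicator)
    also have "\<dots> = (\<integral>\<^sup>+v. f v \<partial>distr P borel V)"
      by (subst nn_integral_distr) simp_all
    also have "\<dots> = (\<integral>\<^sup>+z. f (\<mu> + L z) \<partial>std_gaussian)"
      unfolding law by (subst nn_integral_distr) simp_all
    also have "\<dots> = (\<integral>\<^sup>+z. \<integral>\<^sup>+s. g (s, q z) \<partial>G \<partial>std_gaussian)"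
      unfolding f_def q_def G_def b
      by (rule std_gaussian_linear_image_split[OF L adj a]) (simp add: borel_prod[symmetric])
    also have "\<dots> = (\<integral>\<^sup>+z. emeasure G {s \<in> {s. q z + s *\<^sub>R b \<in> B}. (s, q z) \<in> A} \<partial>std_gaussian)"
    proof (intro nn_integral_cong)
      fix z
      have "(\<integral>\<^sup>+s. g (s, q z) \<partial>G) = (\<integral>\<^sup>+s. indicator {s \<in> {s. q z + s *\<^sub>R b \<in> B}. (s, q z) \<in> A} s \<partial>G)"
        by (intro nn_integral_cong) (auto simp: g_def split: split_indicator)
      also have "\<dots> = emeasure G {s \<in> {s. q z + s *\<^sub>R b \<in> B}. (s, q z) \<in> A}"
        by (rule nn_integral_indicator) simp
      finally show "(\<integral>\<^sup>+s. g (s, q z) \<partial>G) = emeasure G {s \<in> {s. q z + s *\<^sub>R b \<in> B}. (s, q z) \<in> A}" .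
    qed
    finally show ?thesis .
  qed
  have UNIV: "UNIV \<in> sets (borel \<Otimes>\<^sub>M borel :: (real \<times> 'b) measure)"
    unfolding borel_prod by simp
  have "emeasure P {\<omega> \<in> space P. (\<alpha> / 2 \<le> F (V \<omega>) \<and> F (V \<omega>) \<le> 1 - \<alpha> / 2) \<and> V \<omega> \<in> B} =
      (\<integral>\<^sup>+z. emeasure G {s \<in> {s. q z + s *\<^sub>R b \<in> B}. (s, q z) \<in> D} \<partial>std_gaussian)"
    using disintegrate[OF D] by (simp add: D_def F_H)
  \<comment> \<open>For each fixed residual the band identity is applied with the slice as
    truncation set.\<close>
  also have "\<dots> = (\<integral>\<^sup>+z. ennreal (1 - \<alpha>) * emeasure G {s. q z + s *\<^sub>R b \<in> B} \<partial>std_gaussian)"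
    using emeasure_truncated_cdf_central[OF G.real_distribution_axioms atomless slice \<alpha>]
    by (intro nn_integral_cong) (simp add: D_def H_def)
  also have "\<dots> = ennreal (1 - \<alpha>) * (\<integral>\<^sup>+z. emeasure G {s. q z + s *\<^sub>R b \<in> B} \<partial>std_gaussian)"
  proof (rule nn_integral_cmult)
    have "emeasure G {s. q z + s *\<^sub>R b \<in> B} = (\<integral>\<^sup>+s. indicator B (q z + s *\<^sub>R b) \<partial>G)" for z
    proof -
      have "(\<integral>\<^sup>+s. indicator B (q z + s *\<^sub>R b) \<partial>G) = (\<integral>\<^sup>+s. indicator {s. q z + s *\<^sub>R b \<in> B} s \<partial>G)"
        by (intro nn_integral_cong) (auto split: split_indicator)
      then show ?thesis by simp
    qed
    then show "(\<lambda>z. emeasure G {s. q z + s *\<^sub>R b \<in> B}) \<in> borel_measurable std_gaussian"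
      unfolding q_def by simp
  qed
  also have "(\<integral>\<^sup>+z. emeasure G {s. q z + s *\<^sub>R b \<in> B} \<partial>std_gaussian) =
      emeasure P {\<omega> \<in> space P. V \<omega> \<in> B}"
    using disintegrate[OF UNIV] by simp
  finally show ?thesis
    using \<alpha> by (simp add: P.emeasure_eq_measure ennreal_mult[symmetric])
qed

section \<open>Stacked vectors and their joint Gaussian law\<close>

text \<open>A product of sigma-finite laws is determined by its values on rectangles, where
  independence of the generated sigma-algebras gives the product formula.\<close>

lemma distr_Pair_indep_vecs:
  assumes P: "prob_space P" and [measurable]: "V \<in> borel_measurable P" "W \<in> borel_measurable P"
    and indep: "indep_vecs P V W"
  shows "distr P (borel \<Otimes>\<^sub>M borel) (\<lambda>\<omega>. (V \<omega>, W \<omega>)) = distr P borel V \<Otimes>\<^sub>M distr P borel W"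
proof (rule pair_measure_eqI[symmetric])
  interpret P: prob_space P by fact
  show "sigma_finite_measure (distr P borel V)" "sigma_finite_measure (distr P borel W)"
    by (intro prob_space_imp_sigma_finite P.prob_space_distr; simp)+
  show "sets (distr P borel V \<Otimes>\<^sub>M distr P borel W) = sets (distr P (borel \<Otimes>\<^sub>M borel) (\<lambda>\<omega>. (V \<omega>, W \<omega>)))"
    by (simp cong: sets_pair_measure_cong)
  fix A B assume "A \<in> sets (distr P borel V)" "B \<in> sets (distr P borel W)"
  then have [measurable]: "A \<in> sets borel" "B \<in> sets borel"
    by simp_all
  have "P.prob ((V -` A \<inter> space P) \<inter> (W -` B \<inter> space P)) =
      P.prob (V -` A \<inter> space P) * P.prob (W -` B \<inter> space P)"
    by (rule P.indep_setD[OF indep[unfolded indep_vecs_def]]) auto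
  moreover have "(\<lambda>\<omega>. (V \<omega>, W \<omega>)) -` (A \<times> B) \<inter> space P = (V -` A \<inter> space P) \<inter> (W -` B \<inter> space P)"
    by auto
  ultimately show "emeasure (distr P borel V) A * emeasure (distr P borel W) B =
      emeasure (distr P (borel \<Otimes>\<^sub>M borel) (\<lambda>\<omega>. (V \<omega>, W \<omega>))) (A \<times> B)"
    by (simp add: emeasure_distr P.emeasure_eq_measure ennreal_mult)
qed

lemma stack_nth [simp]:
  "stack u v $ (Inl i, k) = u $ (i, k)" "stack u v $ (Inr j, k) = v $ (j, k)"
  by (simp_all add: stack_def)

lemma stack_eqI:
  assumes "\<And>i k. w $ (Inl i, k) = u $ (i, k)" "\<And>j k. w $ (Inr j, k) = v $ (j, k)"
  shows "w = stack u v"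
  unfolding vec_eq_iff
proof
  fix p show "w $ p = stack u v $ p"
    using assms by (cases p; cases "fst p") auto
qed

lemma stack_add: "stack (u + u') (v + v') = stack u v + stack u' v'"
  by (rule stack_eqI[symmetric]) simp_all

lemma stack_scaleR: "stack (c *\<^sub>R u) (c *\<^sub>R v) = c *\<^sub>R stack u v"
  by (rule stack_eqI[symmetric]) simp_all

lemma linear_stack: "linear (\<lambda>(u, v). stack u v)"
  by (rule linearI) (auto simp: stack_add stack_scaleR)

lemma sum_stack_index:
  fixes f :: "('n::finite + 'm::finite) \<times> 'd::finite \<Rightarrow> real"
  shows "(\<Sum>p\<in>UNIV. f p) =
    (\<Sum>(i, k)\<in>UNIV. f (Inl i, k)) + (\<Sum>(j, k)\<in>UNIV. f (Inr j, k))"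
proof -
  have "(\<Sum>p\<in>UNIV. f p) = (\<Sum>r\<in>(UNIV :: 'n set) <+> (UNIV :: 'm set). \<Sum>k\<in>UNIV. f (r, k))"
    by (simp add: sum.cartesian_product)
  also have "\<dots> = (\<Sum>i\<in>UNIV. \<Sum>k\<in>UNIV. f (Inl i, k)) + (\<Sum>j\<in>UNIV. \<Sum>k\<in>UNIV. f (Inr j, k))"
    by (subst sum.Plus) simp_all
  finally show ?thesis
    by (simp add: sum.cartesian_product)
qed

lemma inner_stack: "stack u v \<bullet> stack u' v' = u \<bullet> u' + v \<bullet> v'"
  by (simp add: inner_vec_def sum_stack_index case_prod_unfold)

lemma block_diag_stack: "block_diag A B *v stack u v = stack (A *v u) (B *v v)"
  by (rule stack_eqI)
     (simp_all add: matrix_vector_mult_def sum_stack_index block_diag_def case_prod_unfold)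

lemma stack_surj: "\<exists>u v. w = stack u v"
  by (rule exI[of _ "\<chi> p. w $ (Inl (fst p), snd p)"], rule exI[of _ "\<chi> p. w $ (Inr (fst p), snd p)"])
     (rule stack_eqI; simp)

lemma inner_matrix_transpose: "(x :: real ^ 'n) \<bullet> (A *v y) = (transpose A *v x) \<bullet> y"
  by (simp add: dot_lmul_matrix[symmetric])

text \<open>The matrix product is the rank-one operator sending \<open>v\<close> to
  \<open>\<eta> \<bullet> v\<close> times \<open>b\<close>.\<close>

lemma q_mul_eq: "q_mul \<Sigma> \<eta> v = v - (\<eta> \<bullet> v) *\<^sub>R b_mul \<Sigma> \<eta>"
proof -
  have "((columnvector b :: real ^ 1 ^ 'a) ** rowvector \<eta>) *v v = (\<eta> \<bullet> v) *\<^sub>R b" for b :: "real ^ 'a"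
    by (simp add: vec_eq_iff matrix_vector_mult_def matrix_matrix_mult_def columnvector_def
        rowvector_def inner_vec_def sum_distrib_right mult.assoc mult.left_commute)
       (simp add: mult.commute sum_distrib_left mult.left_commute)
  then show ?thesis
    by (simp add: q_mul_def matrix_vector_mult_diff_rdistrib)
qed

text \<open>The square roots of the two covariance matrices act on independent standard normal vectors,
  so that the pair is the image of a standard normal vector on the product space.\<close>

lemma multivariate_normal_stack:
  assumes P: "prob_space P"
    and V: "multivariate_normal P V \<mu> \<Sigma>" and W: "multivariate_normal P W \<nu> T"
    and indep: "indep_vecs P V W"
  obtains L :: "(real ^ ('n::finite \<times> 'd::finite)) \<times> (real ^ ('m::finite \<times> 'd)) \<Rightarrow> real ^ (('n + 'm) \<times> 'd)"
    and R where "linear L"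
    and "distr P borel (\<lambda>\<omega>. stack (V \<omega>) (W \<omega>)) = distr std_gaussian borel (\<lambda>z. stack \<mu> \<nu> + L z)"
    and "\<And>\<eta> z. \<eta> \<bullet> L z = R \<eta> \<bullet> z" and "\<And>\<eta>. L (R \<eta>) = block_diag \<Sigma> T *v \<eta>"
proof -
  interpret P: prob_space P by fact
  have [measurable]: "V \<in> borel_measurable P" "W \<in> borel_measurable P"
    using V W by (simp_all add: multivariate_normal_def)
  obtain A :: "real ^ ('n \<times> 'd) ^ ('n \<times> 'd)" where A: "A ** transpose A = \<Sigma>" "distr P borel V = distr std_gaussian borel (\<lambda>z. \<mu> + A *v z)"
    using V unfolding multivariate_normal_def std_gaussian_vec by blast
  obtain B :: "real ^ ('m \<times> 'd) ^ ('m \<times> 'd)" where B: "B ** transpose B = T" "distr P borel W = distr std_gaussian borel (\<lambda>z. \<nu> + B *v z)"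
    using W unfolding multivariate_normal_def std_gaussian_vec by blast
  have [measurable]: "(\<lambda>z. A *v z) \<in> borel_measurable borel" "(\<lambda>z. B *v z) \<in> borel_measurable borel"
    by (intro borel_measurable_continuous_onI matrix_vector_mult_linear_continuous_on)+
  have stack[measurable]: "(\<lambda>(u, v). stack u v :: real ^ (('n + 'm) \<times> 'd)) \<in>
      borel_measurable (borel \<Otimes>\<^sub>M borel)"
    unfolding borel_prod using linear_stack
    by (intro borel_measurable_continuous_onI linear_continuous_on linear_conv_bounded_linear[THEN iffD1])
  define L where "L = (\<lambda>(x, y). stack (A *v x) (B *v y) :: real ^ (('n + 'm) \<times> 'd))"
  \<comment> \<open>\<open>R\<close> is the adjoint of \<open>L\<close>, with the two blocks of
    \<open>\<eta>\<close> read off by index. Composing gives the blocks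
    \<open>A ** transpose A\<close> and \<open>B ** transpose B\<close>, that is, the
    covariance.\<close>
  define R where "R = (\<lambda>\<eta> :: real ^ (('n + 'm) \<times> 'd).
    (transpose A *v (\<chi> p. \<eta> $ (Inl (fst p), snd p)), transpose B *v (\<chi> p. \<eta> $ (Inr (fst p), snd p))))"
  have R: "R (stack u v) = (transpose A *v u, transpose B *v v)" for u v
    by (simp add: R_def)
  have sf: "sigma_finite_measure (distr std_gaussian borel (\<lambda>z. \<nu> + B *v z))"
    unfolding B(2)[symmetric] by (intro prob_space_imp_sigma_finite P.prob_space_distr) simp
  \<comment> \<open>Independence makes the joint law a product, which is then pulled back to a
    product of standard Gaussians.\<close>
  have "distr P borel (\<lambda>\<omega>. stack (V \<omega>) (W \<omega>)) =
      distr (distr P borel V \<Otimes>\<^sub>M distr P borel W) borel (\<lambda>(u, v). stack u v)"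
    by (subst distr_Pair_indep_vecs[OF P _ _ indep, symmetric]) (simp_all add: distr_distr comp_def)
  also have "\<dots> = distr (std_gaussian \<Otimes>\<^sub>M std_gaussian) borel
      (\<lambda>(x, y). stack (\<mu> + A *v x) (\<nu> + B *v y))"
    unfolding A(2) B(2)
    by (subst pair_measure_distr[OF _ _ sf]) (simp_all add: distr_distr comp_def case_prod_unfold)
  also have "\<dots> = distr std_gaussian borel (\<lambda>z. stack \<mu> \<nu> + L z)"
    by (simp add: std_gaussian_prod L_def stack_add case_prod_unfold)
  finally have "distr P borel (\<lambda>\<omega>. stack (V \<omega>) (W \<omega>)) =
      distr std_gaussian borel (\<lambda>z. stack \<mu> \<nu> + L z)" .
  moreover have "linear L"
    by (rule linearI)
       (auto simp: L_def matrix_vector_right_distrib stack_add matrix_vector_mult_scaleR stack_scaleR)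
  moreover have "\<eta> \<bullet> L z = R \<eta> \<bullet> z" for \<eta> z
  proof -
    obtain u v where "\<eta> = stack u v" using stack_surj by blast
    then show ?thesis
      by (simp add: L_def R case_prod_unfold inner_stack inner_matrix_transpose inner_prod_def)
  qed
  moreover have "L (R \<eta>) = block_diag \<Sigma> T *v \<eta>" for \<eta>
  proof -
    obtain u v where "\<eta> = stack u v" using stack_surj by blast
    then show ?thesis
      by (simp add: L_def R block_diag_stack A(1)[symmetric] B(1)[symmetric] matrix_vector_mul_assoc
          del: transpose_matrix_vector)
  qed
  ultimately show ?thesis
    using that by blast
qed

section \<open>The selection event and coverage of the confidence set\<close>

text \<open>Unstacking is linear, hence continuous. The signs give finitely many conditions on
  coordinate differences, and the basis condition is the preimage of a single value under
  \<open>\<M>\<close>.\<close>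

lemma measurable_selection_event:
  fixes \<M> :: "real ^ 'd::finite ^ 'n::finite \<Rightarrow> real ^ 'd ^ 'm::finite \<Rightarrow> ('n \<times> 'm) set"
  assumes \<M>: "(\<lambda>(x, y). \<M> x y) \<in> borel \<rightarrow>\<^sub>M count_space UNIV"
  shows "{v. selection_event \<M> Xobs Yobs (unstack_X v) (unstack_Y v)} \<in> sets borel"
proof -
  have "linear (\<lambda>v. (unstack_X v, unstack_Y v) :: (real ^ 'd ^ 'n) \<times> (real ^ 'd ^ 'm))"
    by (rule linearI) (simp_all add: unstack_X_def unstack_Y_def vec_eq_iff)
  then have unstack: "(\<lambda>v. (unstack_X v, unstack_Y v) :: (real ^ 'd ^ 'n) \<times> (real ^ 'd ^ 'm)) \<in> borel_measurable borel"
    by (intro borel_measurable_continuous_onI linear_continuous_on linear_conv_bounded_linear[THEN iffD1])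
  have [measurable]: "(\<lambda>v. \<M> (unstack_X v) (unstack_Y v)) \<in> borel \<rightarrow>\<^sub>M count_space UNIV"
    using measurable_compose[OF unstack \<M>] by simp
  have sign: "(sign_vec k x y = s) = (\<forall>i j. sgn (x $ i $ k - y $ j $ k) = s $ (i, j))"
    for k s and x :: "real ^ 'd ^ 'n" and y :: "real ^ 'd ^ 'm"
    by (simp add: vec_eq_iff sign_vec_def Omega_stack)
  have nth: "unstack_X v $ i $ k = v $ (Inl i, k)" "unstack_Y v $ j $ k = v $ (Inr j, k)"
    for v :: "real ^ (('n + 'm) \<times> 'd)" and i j k
    by (simp_all add: unstack_X_def unstack_Y_def)
  have "{v \<in> space borel. selection_event \<M> Xobs Yobs (unstack_X v) (unstack_Y v)} \<in> sets borel"
    unfolding selection_event_def sign nth by measurable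
  then show ?thesis by simp
qed

theorem mainTheorem2:
  fixes P :: "'w measure"
    and X :: "'w \<Rightarrow> real ^ 'd::finite ^ 'n::finite"
    and Y :: "'w \<Rightarrow> real ^ 'd ^ 'm::{finite,linorder}"
    and \<mu>X :: "real ^ ('n \<times> 'd)" and \<Sigma>X :: "real ^ ('n \<times> 'd) ^ ('n \<times> 'd)"
    and \<mu>Y :: "real ^ ('m \<times> 'd)" and \<Sigma>Y :: "real ^ ('m \<times> 'd) ^ ('m \<times> 'd)"
    and \<M> :: "real ^ 'd ^ 'n \<Rightarrow> real ^ 'd ^ 'm::{finite,linorder} \<Rightarrow> ('n \<times> 'm) set"
    and Xobs :: "real ^ 'd ^ 'n" and Yobs :: "real ^ 'd ^ 'm::{finite,linorder}"
    and \<alpha> :: real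
  defines "\<Sigma> \<equiv> block_diag \<Sigma>X \<Sigma>Y"
    and "\<eta> \<equiv> eta_mul \<M> Xobs Yobs"
  assumes "prob_space P"
    and "multivariate_normal P (\<lambda>\<omega>. vec_rows (X \<omega>)) \<mu>X \<Sigma>X"
    and "multivariate_normal P (\<lambda>\<omega>. vec_rows (Y \<omega>)) \<mu>Y \<Sigma>Y"
    and "indep_vecs P (\<lambda>\<omega>. vec_rows (X \<omega>)) (\<lambda>\<omega>. vec_rows (Y \<omega>))"
    and "lp_nondegenerate (S_ot :: real ^ ('n \<times> 'm) ^ ('n, 'm) constr) h_ot"
    and "\<And>x y. optimal_basis S_ot h_ot (cost_vec x y) (\<M> x y)"
    and "(\<lambda>(x, y). \<M> x y) \<in> borel \<rightarrow>\<^sub>M count_space UNIV"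
    and "\<P>(\<omega> in P. selection_event \<M> Xobs Yobs (X \<omega>) (Y \<omega>)) > 0"
    and "\<eta> \<bullet> (\<Sigma> *v \<eta>) > 0"
    and "0 \<le> \<alpha>" and "\<alpha> \<le> 1"
  shows "\<P>(\<omega> in P. \<eta> \<bullet> stack \<mu>X \<mu>Y \<in> C_sel_mul \<alpha> \<M> Xobs Yobs \<Sigma> (X \<omega>) (Y \<omega>)
            \<bar> selection_event \<M> Xobs Yobs (X \<omega>) (Y \<omega>)) = 1 - \<alpha>"
proof -
  interpret P: prob_space P by fact
  define V where "V = (\<lambda>\<omega>. stack (vec_rows (X \<omega>)) (vec_rows (Y \<omega>)))"
  define B where "B = {v. selection_event \<M> Xobs Yobs (unstack_X v) (unstack_Y v)}"
  obtain L :: "(real ^ ('n \<times> 'd)) \<times> (real ^ ('m \<times> 'd)) \<Rightarrow> real ^ (('n + 'm) \<times> 'd)" and R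
    where L: "linear L"
    and law: "distr P borel V = distr std_gaussian borel (\<lambda>z. stack \<mu>X \<mu>Y + L z)"
    and adj: "\<And>\<eta> z. \<eta> \<bullet> L z = R \<eta> \<bullet> z" and LR: "\<And>\<eta>. L (R \<eta>) = \<Sigma> *v \<eta>"
    unfolding V_def \<Sigma>_def by (rule multivariate_normal_stack[OF assms(3-6)]) blast
  \<comment> \<open>The variance is the squared norm of \<open>R \<eta>\<close>: its positivity
    makes \<open>R \<eta>\<close> nonzero, and \<open>b_mul\<close> becomes the \<open>b\<close> of
    the pivot lemma.\<close>
  have var: "R \<eta> \<bullet> R \<eta> = \<eta> \<bullet> (\<Sigma> *v \<eta>)"
    by (simp add: adj[symmetric] LR)
  have V: "V \<in> borel_measurable P"
  proof -
    have "(\<lambda>(u, v). stack u v :: real ^ (('n + 'm) \<times> 'd)) \<in> borel_measurable borel"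
      using linear_stack
      by (intro borel_measurable_continuous_onI linear_continuous_on linear_conv_bounded_linear[THEN iffD1])
    then show ?thesis
      unfolding V_def using assms(4,5) unfolding multivariate_normal_def
      by (auto intro: measurable_compose[OF borel_measurable_Pair, where g="\<lambda>(u, v). stack u v", simplified])
  qed
  have "R \<eta> \<noteq> 0"
    using var assms(11) by auto
  moreover have "B \<in> sets borel"
    unfolding B_def using assms(9) by (rule measurable_selection_event)
  moreover have "b_mul \<Sigma> \<eta> = inverse (R \<eta> \<bullet> R \<eta>) *\<^sub>R L (R \<eta>)"
    by (simp add: b_mul_def var LR)
  \<comment> \<open>The residual here is \<open>q_mul\<close>, so the slice of \<open>B\<close> at
    \<open>V \<omega>\<close> is exactly \<open>Z_mul\<close>.\<close>
  ultimately have pivot: "\<P>(\<omega> in P. (\<alpha> / 2 \<le> F (V \<omega>) \<and> F (V \<omega>) \<le> 1 - \<alpha> / 2) \<and> V \<omega> \<in> B) =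
      (1 - \<alpha>) * \<P>(\<omega> in P. V \<omega> \<in> B)"
    if "F = (\<lambda>v. truncated_normal_cdf {z. v - (\<eta> \<bullet> v) *\<^sub>R b_mul \<Sigma> \<eta> + z *\<^sub>R b_mul \<Sigma> \<eta> \<in> B}
      (\<eta> \<bullet> stack \<mu>X \<mu>Y) (R \<eta> \<bullet> R \<eta>) (\<eta> \<bullet> v))" for F
    unfolding that using gaussian_truncated_pivot[OF assms(3) V law L adj] assms(12,13) by blast
  have "V \<omega> \<in> B \<longleftrightarrow> selection_event \<M> Xobs Yobs (X \<omega>) (Y \<omega>)" for \<omega>
    by (simp add: B_def V_def)
  \<comment> \<open>Dividing by the positive selection probability gives the conditional
    statement.\<close>
  with pivot[OF refl] assms(10) show ?thesis
    by (simp add: cond_prob_def C_sel_mul_def Z_mul_def Let_def q_mul_eq B_def V_def var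
        \<eta>_def[symmetric] del: unstack_stack)
qed

end
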